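(* Every L$^\natural$-convex function $f:\mathbb{Z}^n\to\mathbb{R}\cup\{+\infty\}$ is DDM-convex.
   Context: A function $f:\mathbb{Z}^n\to\mathbb{R}\cup\{+\infty\}$ is L$^\natural$-convex if it is translation-submodular, i.e. $f(x)+f(y)\ge f((x-\alpha\mathbf{1})\vee y)+f(x\wedge(y+\alpha\mathbf{1}))$ for all $x,y\in\mathbb{Z}^n$ and all nonnegative integers $\alpha$, where $\mathbf{1}$ is the all-ones vector and $p\vee q$, $p\wedge q$ denote the componentwise maximum and minimum of $p$ and $q$. For $x,y\in\mathbb{Z}^n$, the vector $\mu(x,y)\in\mathbb{Z}^n$ is defined componentwise by $\mu(x,y)_i=\lceil (x_i+y_i)/2\rceil$ if $x_i\ge y_i$, and $\mu(x,y)_i=\lfloor (x_i+y_i)/2\rfloor$ if $x_i<y_i$. A function $f:\mathbb{Z}^n\to\mathbb{R}\cup\{+\infty\}$ is called DDM-convex if $f(x)+f(y)\ge f(\mu(x,y))+f(\mu(y,x))$ for all $x,y\in\mathbb{Z}^n$. *)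

theory Defs
  imports "HOL-Analysis.Analysis"
begin

(* Functions Z^n -> R Un {+infinity} are modelled as f :: int ^ 'n => ereal together with
   the side condition "ALL x. f x ~= - infinity", which is stated where such an f is
   introduced and is not part of the convexity predicates below. *)

(* The library provides lattice operations on vectors only for real-like component types. *)
definition vmax :: "int ^ 'n \<Rightarrow> int ^ 'n \<Rightarrow> int ^ 'n"  (infixl \<open>\<or>\<^sub>v\<close> 65)
  where "p \<or>\<^sub>v q = (\<chi> i. max (p $ i) (q $ i))"

definition vmin :: "int ^ 'n \<Rightarrow> int ^ 'n \<Rightarrow> int ^ 'n"  (infixl \<open>\<and>\<^sub>v\<close> 65)
  where "p \<and>\<^sub>v q = (\<chi> i. min (p $ i) (q $ i))"

(* L-natural convexity (translation-submodularity); the vector 1 is the all-ones vector. *)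
definition L_natural_convex :: "(int ^ 'n \<Rightarrow> ereal) \<Rightarrow> bool"
  where "L_natural_convex f \<longleftrightarrow>
    (\<forall>x y. \<forall>\<alpha>\<ge>0. f x + f y \<ge> f ((x - \<alpha> *s 1) \<or>\<^sub>v y) + f (x \<and>\<^sub>v (y + \<alpha> *s 1)))"

definition directed_midpoint :: "int ^ 'n \<Rightarrow> int ^ 'n \<Rightarrow> int ^ 'n"  (\<open>\<mu>\<close>)
  where "\<mu> x y =
    (\<chi> i. if x $ i \<ge> y $ i
          then \<lceil>real_of_int (x $ i + y $ i) / 2\<rceil>
          else \<lfloor>real_of_int (x $ i + y $ i) / 2\<rfloor>)"

definition DDM_convex :: "(int ^ 'n \<Rightarrow> ereal) \<Rightarrow> bool"
  where "DDM_convex f \<longleftrightarrow> (\<forall>x y. f x + f y \<ge> f (\<mu> x y) + f (\<mu> y x))"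

end

theory Submission
  imports Defs
begin

text \<open>
  The idea is to move from \<open>(x, y)\<close> to \<open>(\<mu> x y, \<mu> y x)\<close> by unit steps, never increasing
  \<open>f x + f y\<close>. Let \<open>m\<close> be the largest value of \<open>x $ i - y $ i\<close> and suppose \<open>m \<ge> 2\<close>.
  Translation-submodularity with \<open>\<alpha> = m - 1\<close> acts only on the coordinates where the
  difference is exactly \<open>m\<close>: there it lowers \<open>x\<close> by one and raises \<open>y\<close> by one, up to
  exchanging the names of the two new points.

  Such a step preserves the coordinatewise sum and, because \<open>m \<ge> 2\<close>, reverses the sign of
  no difference; hence it preserves both directed midpoints (\<open>directed_midpoint_step\<close>). It
  also shrinks the \<open>l\<^sub>1\<close> distance of the two points. Exchanging \<open>x\<close> and \<open>y\<close> treats the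
  coordinates whose difference is at most \<open>-2\<close>. The process therefore ends in a pair that
  differs by at most one in each coordinate, and rounding each midpoint towards its own
  endpoint returns exactly that pair (\<open>directed_midpoint_near\<close>).
\<close>

lemma directed_midpoint_nth:
  "\<mu> x y $ i = (if y $ i \<le> x $ i then (x $ i + y $ i + 1) div 2 else (x $ i + y $ i) div 2)"
proof -
  have "\<lfloor>real_of_int k / 2\<rfloor> = k div 2" for k :: int
    using floor_divide_of_int_eq[of k 2, where ?'a = real] by simp
  moreover have "\<lceil>real_of_int k / 2\<rceil> = (k + 1) div 2" for k :: int
  proof (rule ceiling_unique)
    have "2 * ((k + 1) div 2) < k + 2" "k \<le> 2 * ((k + 1) div 2)"
      by presburger+
    then have "2 * real_of_int ((k + 1) div 2) < real_of_int k + 2"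
      "real_of_int k \<le> 2 * real_of_int ((k + 1) div 2)"
      by linarith+
    then show "real_of_int ((k + 1) div 2) - 1 < real_of_int k / 2"
      "real_of_int k / 2 \<le> real_of_int ((k + 1) div 2)"
      by simp_all
  qed
  ultimately show ?thesis
    unfolding directed_midpoint_def by (simp del: of_int_add)
qed

lemma directed_midpoint_near:
  fixes x y :: "int ^ 'n"
  assumes "\<And>i. \<bar>x $ i - y $ i\<bar> \<le> 1"
  shows "\<mu> x y = x"
proof (rule vec_eq_iff[THEN iffD2], rule allI)
  fix i
  have "x $ i = y $ i \<or> x $ i = y $ i + 1 \<or> x $ i = y $ i - 1"
    using assms[of i] by arith
  then show "\<mu> x y $ i = x $ i"
    unfolding directed_midpoint_nth by auto
qed

text \<open>
  When a difference drops from \<open>2\<close> to \<open>0\<close> the rounding direction may change, but then the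
  sum of the two coordinates is even and nothing is rounded.
\<close>

lemma directed_midpoint_step:
  fixes x y x' y' :: "int ^ 'n"
  assumes "\<And>i. x' $ i = x $ i \<and> y' $ i = y $ i \<or>
    2 \<le> x $ i - y $ i \<and> x' $ i = x $ i - 1 \<and> y' $ i = y $ i + 1"
  shows "\<mu> x' y' = \<mu> x y" and "\<mu> y' x' = \<mu> y x"
proof -
  have "\<mu> x' y' $ i = \<mu> x y $ i \<and> \<mu> y' x' $ i = \<mu> y x $ i" for i
    using assms[of i]
  proof (elim disjE conjE)
    assume "x' $ i = x $ i" "y' $ i = y $ i"
    then show ?thesis
      by (simp add: directed_midpoint_nth)
  next
    assume d: "2 \<le> x $ i - y $ i" and step: "x' $ i = x $ i - 1" "y' $ i = y $ i + 1"
    show ?thesis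
    proof (cases "x $ i = y $ i + 2")
      case True
      then show ?thesis
        using step by (simp add: directed_midpoint_nth)
    next
      case False
      then have "y' $ i < x' $ i" "y $ i < x $ i" "x' $ i + y' $ i = x $ i + y $ i"
        using d step by linarith+
      then show ?thesis
        by (simp add: directed_midpoint_nth add.commute)
    qed
  qed
  then show "\<mu> x' y' = \<mu> x y" "\<mu> y' x' = \<mu> y x"
    by (simp_all add: vec_eq_iff)
qed

text \<open>
  For \<open>\<alpha> = m - 1\<close> with \<open>m\<close> the largest difference, the point \<open>x \<and>\<^sub>v (y + \<alpha> *s 1)\<close> takes the
  role of \<open>x\<close> and \<open>(x - \<alpha> *s 1) \<or>\<^sub>v y\<close> that of \<open>y\<close>: with this naming a coordinate of difference
  at most \<open>\<alpha>\<close> is left alone, including every coordinate where \<open>x $ i < y $ i\<close>. A smaller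
  \<open>\<alpha>\<close> could overshoot, since a difference \<open>d > \<alpha>\<close> becomes \<open>2 * \<alpha> - d\<close>, which may be negative.
\<close>

lemma L_natural_convex_contract:
  fixes f :: "int ^ 'n \<Rightarrow> ereal" and x y :: "int ^ 'n"
  assumes f: "L_natural_convex f" and j: "2 \<le> x $ j - y $ j"
  obtains x' y' where "f x' + f y' \<le> f x + f y"
    and "\<mu> x' y' = \<mu> x y" and "\<mu> y' x' = \<mu> y x"
    and "(\<Sum>i\<in>UNIV. \<bar>x' $ i - y' $ i\<bar>) < (\<Sum>i\<in>UNIV. \<bar>x $ i - y $ i\<bar>)"
proof -
  define m where "m = (MAX i. x $ i - y $ i)"
  have le_m: "x $ i - y $ i \<le> m" for i
    unfolding m_def by (rule Max_ge) auto
  have "m \<in> range (\<lambda>i. x $ i - y $ i)"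
    unfolding m_def by (rule Max_in) auto
  then obtain k where k: "x $ k - y $ k = m"
    by auto
  have m: "2 \<le> m"
    using j le_m[of j] by linarith
  define x' where "x' = x \<and>\<^sub>v (y + (m - 1) *s 1)"
  define y' where "y' = (x - (m - 1) *s 1) \<or>\<^sub>v y"
  have x'_nth: "x' $ i = (if x $ i - y $ i = m then x $ i - 1 else x $ i)"
    and y'_nth: "y' $ i = (if x $ i - y $ i = m then y $ i + 1 else y $ i)" for i
    using le_m[of i] by (auto simp: x'_def y'_def vmin_def vmax_def min_def max_def)
  show thesis
  proof (rule that)
    have "f y' + f x' \<le> f x + f y"
      using f[unfolded L_natural_convex_def, rule_format, of "m - 1" x y] m
      unfolding x'_def y'_def by linarith
    then show "f x' + f y' \<le> f x + f y"
      by (simp add: add.commute)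
    have step: "x' $ i = x $ i \<and> y' $ i = y $ i \<or>
        2 \<le> x $ i - y $ i \<and> x' $ i = x $ i - 1 \<and> y' $ i = y $ i + 1" for i
      using m by (simp add: x'_nth y'_nth)
    show "\<mu> x' y' = \<mu> x y" "\<mu> y' x' = \<mu> y x"
      using directed_midpoint_step[OF step] by simp_all
    show "(\<Sum>i\<in>UNIV. \<bar>x' $ i - y' $ i\<bar>) < (\<Sum>i\<in>UNIV. \<bar>x $ i - y $ i\<bar>)"
    proof (rule sum_strict_mono_ex1)
      show "\<forall>i\<in>UNIV. \<bar>x' $ i - y' $ i\<bar> \<le> \<bar>x $ i - y $ i\<bar>"
        using m by (auto simp: x'_nth y'_nth)
      show "\<exists>i\<in>UNIV. \<bar>x' $ i - y' $ i\<bar> < \<bar>x $ i - y $ i\<bar>"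
        using m k by (intro bexI[of _ k]) (auto simp: x'_nth y'_nth)
    qed simp
  qed
qed

theorem proposition3p5:
  fixes f :: "int ^ 'n \<Rightarrow> ereal"
  assumes "\<forall>x. f x \<noteq> - \<infinity>"
    and "L_natural_convex f"
  shows "DDM_convex f"
proof -
  have "f (\<mu> x y) + f (\<mu> y x) \<le> f x + f y" for x y
  proof (induction "nat (\<Sum>i\<in>UNIV. \<bar>x $ i - y $ i\<bar>)" arbitrary: x y rule: less_induct)
    case less
    have far: "f (\<mu> u v) + f (\<mu> v u) \<le> f u + f v"
      if j: "2 \<le> u $ j - v $ j"
        and dist: "(\<Sum>i\<in>UNIV. \<bar>u $ i - v $ i\<bar>) = (\<Sum>i\<in>UNIV. \<bar>x $ i - y $ i\<bar>)" for u v j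
    proof -
      obtain u' v' where le: "f u' + f v' \<le> f u + f v"
        and mid: "\<mu> u' v' = \<mu> u v" "\<mu> v' u' = \<mu> v u"
        and closer: "(\<Sum>i\<in>UNIV. \<bar>u' $ i - v' $ i\<bar>) < (\<Sum>i\<in>UNIV. \<bar>u $ i - v $ i\<bar>)"
        using L_natural_convex_contract[OF assms(2) j] by blast
      have "0 \<le> (\<Sum>i\<in>UNIV. \<bar>u' $ i - v' $ i\<bar>)"
        by (simp add: sum_nonneg)
      then have "f (\<mu> u' v') + f (\<mu> v' u') \<le> f u' + f v'"
        using closer dist by (intro less) linarith
      then show ?thesis
        using le mid by simp
    qed
    consider "\<And>i. \<bar>x $ i - y $ i\<bar> \<le> 1" | j where "2 \<le> x $ j - y $ j" | j where "2 \<le> y $ j - x $ j"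
      by (metis abs_le_iff minus_diff_eq not_less zless_imp_add1_zle one_add_one)
    then show ?case
    proof cases
      case 1
      then have "\<mu> x y = x" "\<mu> y x = y"
        by (auto intro!: directed_midpoint_near simp: abs_minus_commute)
      then show ?thesis
        by simp
    next
      case 2
      then show ?thesis
        using far by blast
    next
      case 3
      then have "f (\<mu> y x) + f (\<mu> x y) \<le> f y + f x"
        using far[of y _ x] by (simp add: abs_minus_commute)
      then show ?thesis
        by (simp add: add.commute)
    qed
  qed
  then show ?thesis
    unfolding DDM_convex_def by blast
qed

end
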